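(* The generating function $G(z;u,v)$ of all labelled diagrams associated with $X^2+D^2$ is $$G(z;u,v)=\frac{1}{\sqrt{\cos(2z)}}\cdot\exp\left(\tfrac12(u^2+v^2)\tan(2z)+uv\,(\sec(2z)-1)\right).$$
   Context: Labelled diagrams associated with $X^2+D^2$: a labelled diagram of size $n$ has inner nodes (gates) labelled $1,\dots,n$, each being either an $X^2$-gate (two ordered output slots, no input slot) or a $D^2$-gate (two ordered input slots, no output slot), together with a set of connections, each joining an output slot of a node $i$ to an input slot of a node $j$ with $i<j$, every slot being used at most once. Slots of a node are distinguishable. Unconnected output slots are the outputs of the diagram; unconnected input slots are its inputs. Diagrams need not be connected. $G(z;u,v)=\sum_{n,a,b} c_{n,a,b}\,u^av^b\,\frac{z^n}{n!}$, where $c_{n,a,b}$ is the number of labelled diagrams of size $n$ with $a$ outputs and $b$ inputs. (Equivalently, $c_{n,a,b}$ is the coefficient of $X^aD^b$ in the normal form of $(X^2+D^2)^n$ when $DX-XD=1$, normal form meaning that all $X$'s are to the left of all $D$'s.) The identity is one of formal power series in $z$. *)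

theory Defs
  imports
    "HOL-Computational_Algebra.Formal_Power_Series"
    "HOL-Library.FuncSet"
begin

datatype gate = X2_gate | D2_gate

datatype side = First | Second

type_synonym slot = "nat \<times> side"

type_synonym diagram = "(nat \<Rightarrow> gate) \<times> (slot \<times> slot) set"

definition output_slots :: "nat \<Rightarrow> (nat \<Rightarrow> gate) \<Rightarrow> slot set" where
  "output_slots n g = {(i, s). i \<in> {1..n} \<and> g i = X2_gate}"

definition input_slots :: "nat \<Rightarrow> (nat \<Rightarrow> gate) \<Rightarrow> slot set" where
  "input_slots n g = {(j, t). j \<in> {1..n} \<and> g j = D2_gate}"

text \<open>A connection is a pair (output slot, input slot). The gate assignment is extensional
  on the label set, so that distinct pairs are distinct diagrams; the two injectivity conditions
  say that every slot is used at most once.\<close>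

definition labelled_diagrams :: "nat \<Rightarrow> diagram set" where
  "labelled_diagrams n =
     {(g, C). g \<in> {1..n} \<rightarrow>\<^sub>E UNIV
            \<and> C \<subseteq> output_slots n g \<times> input_slots n g
            \<and> (\<forall>((i, s), (j, t)) \<in> C. i < j)
            \<and> inj_on fst C \<and> inj_on snd C}"

definition diagram_outputs :: "nat \<Rightarrow> diagram \<Rightarrow> slot set" where
  "diagram_outputs n d = output_slots n (fst d) - fst ` snd d"

definition diagram_inputs :: "nat \<Rightarrow> diagram \<Rightarrow> slot set" where
  "diagram_inputs n d = input_slots n (fst d) - snd ` snd d"

definition diagram_count :: "nat \<Rightarrow> nat \<Rightarrow> nat \<Rightarrow> nat" where
  "diagram_count n a b =
     card {d \<in> labelled_diagrams n.
             card (diagram_outputs n d) = a \<and> card (diagram_inputs n d) = b}"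

lemma slots_subset:
  "output_slots n g \<subseteq> {1..n} \<times> {First, Second}"
  "input_slots n g \<subseteq> {1..n} \<times> {First, Second}"
  by (auto simp: output_slots_def input_slots_def intro: side.exhaust)

lemma finite_labelled_diagrams: "finite (labelled_diagrams n)"
proof (rule finite_subset)
  let ?S = "{1..n} \<times> {First, Second}"
  have "UNIV = {X2_gate, D2_gate}"
    using gate.exhaust by blast
  then have "finite (UNIV :: gate set)"
    by (metis finite.emptyI finite.insertI)
  then show "finite (({1..n} \<rightarrow>\<^sub>E (UNIV :: gate set)) \<times> Pow (?S \<times> ?S))"
    by (intro finite_cartesian_product finite_PiE) auto
  show "labelled_diagrams n \<subseteq> ({1..n} \<rightarrow>\<^sub>E UNIV) \<times> Pow (?S \<times> ?S)"
    using slots_subset unfolding labelled_diagrams_def by blast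
qed

lemma diagram_count_eq_0:
  assumes "a > 2 * n \<or> b > 2 * n"
  shows "diagram_count n a b = 0"
proof -
  have *: "card A \<le> 2 * n" if "A \<subseteq> {1..n} \<times> {First, Second}" for A
    using card_mono[OF _ that] by (simp add: card_cartesian_product)
  have "card (diagram_outputs n d) \<le> 2 * n" "card (diagram_inputs n d) \<le> 2 * n" for d
    unfolding diagram_outputs_def diagram_inputs_def
    by (intro * order_trans[OF Diff_subset] slots_subset)+
  then have "{d \<in> labelled_diagrams n.
      card (diagram_outputs n d) = a \<and> card (diagram_inputs n d) = b} = {}"
    using assms by (auto simp: not_less[symmetric])
  then show ?thesis
    by (simp only: diagram_count_def card.empty)
qed

text \<open>The formal variables u and v are represented by arbitrary elements of an arbitrary field of
  characteristic 0, which may be the field of rational functions in two indeterminates. The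
  summation bounds lose nothing, by \<open>diagram_count_eq_0\<close>.\<close>

definition diagram_gf :: "'a::field_char_0 \<Rightarrow> 'a \<Rightarrow> 'a fps" where
  "diagram_gf u v =
     Abs_fps (\<lambda>n. (\<Sum>a\<le>2 * n. \<Sum>b\<le>2 * n. of_nat (diagram_count n a b) * u ^ a * v ^ b) / fact n)"

text \<open>The square root with constant term 1 of a power series with constant term 1.\<close>

definition fps_sqrt1 :: "'a::field_char_0 fps \<Rightarrow> 'a fps" where
  "fps_sqrt1 f = fps_radical (\<lambda>_ _. 1) 2 f"

lemma fps_sqrt1:
  assumes "fps_nth f 0 = 1"
  shows "fps_sqrt1 f ^ 2 = f" "fps_nth (fps_sqrt1 f) 0 = 1"
  using power_radical[of f "\<lambda>_ _. 1" 1] assms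
  by (simp_all add: fps_sqrt1_def numeral_2_eq_2)

end

theory Submission
  imports Defs
begin

text \<open>
  A diagram of size \<open>n + 1\<close> arises from one of size \<open>n\<close> by appending the node with the largest
  label. All its connections come from earlier nodes, so an \<open>X\<^sup>2\<close>-node adds two outputs, while
  a \<open>D\<^sup>2\<close>-node connects each of its two slots to a different output, or leaves it as an input.
  With \<open>P\<^sub>n(u, v)\<close> the polynomial that counts diagrams of size \<open>n\<close> by outputs and inputs, this says
  \<open>P\<^sub>n\<^sub>+\<^sub>1 = u\<^sup>2 P\<^sub>n + (v + \<partial>/\<partial>u)\<^sup>2 P\<^sub>n\<close>
  (lemmas \<open>sum_labelled_diagrams_Suc\<close> and \<open>output_weight_Suc\<close>). Hence the exponential generating
  function \<open>G\<close> is the unique solution with \<open>G = 1\<close> at \<open>z = 0\<close> of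
  \<open>\<partial>G/\<partial>z = u\<^sup>2 G + (v + \<partial>/\<partial>u)\<^sup>2 G\<close>.

  The right-hand side of the theorem solves this equation. With \<open>T = tan 2z\<close> and
  \<open>B = v (sec 2z - 1)\<close> it factors as \<open>M * exp (u\<^sup>2 T / 2 + u B)\<close>, where
  \<open>M = sqrt (sec 2z) * exp (v\<^sup>2 T / 2)\<close> is free of \<open>u\<close>; applying \<open>v + \<partial>/\<partial>u\<close> to the exponential
  multiplies it by \<open>v + B + u T = v sec 2z + u T\<close>, so both sides of the equation become
  \<open>T + (u\<^sup>2 + v\<^sup>2) sec\<^sup>2 2z + 2 u v T sec 2z\<close> times the same function.

  In the theorem \<open>u\<close> is a field element, so \<open>\<partial>/\<partial>u\<close> makes sense only on coefficients. The
  exponential is therefore expanded by hand in powers of \<open>u\<close>, with coefficients \<open>exp_coeff\<close> that are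
  series in \<open>z\<close>. The equation becomes a relation between these coefficients
  (\<open>exp_coeff_heat\<close>), which identifies them with the counts (\<open>output_weight_eq_nth\<close>), and
  \<open>fps_nth_exp_eq_partial\<close> sums them up again.
\<close>

section \<open>Connecting the slots of a last node\<close>

lemma UNIV_side: "(UNIV :: side set) = {First, Second}"
  using side.exhaust by blast

lemma card_node_slots: "card ({m :: nat} \<times> (UNIV :: side set)) = 2"
  by (simp add: UNIV_side card_cartesian_product)

lemma finite_node_slots: "finite ({m :: nat} \<times> (UNIV :: side set))"
  by (simp add: UNIV_side)

lemma finite_slots: "finite (output_slots n g)" "finite (input_slots n g)"
  by (auto intro: finite_subset[OF slots_subset(1)] finite_subset[OF slots_subset(2)])

text \<open>The ways in which the two input slots of a last \<open>D\<^sup>2\<close>-node \<open>m\<close> can be connected to the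
  set \<open>Q\<close> of available outputs.\<close>

definition attachments :: "nat \<Rightarrow> slot set \<Rightarrow> (slot \<times> slot) set set" where
  "attachments m Q = {K. K \<subseteq> Q \<times> ({m} \<times> UNIV) \<and> inj_on fst K \<and> inj_on snd K}"

lemma attachments_eq:
  "attachments m Q =
     insert {} ((\<lambda>(q, t). {(q, (m, t))}) ` (Q \<times> UNIV)
       \<union> (\<lambda>(q, r). {(q, (m, First)), (r, (m, Second))}) ` (SIGMA q:Q. Q - {q}))"
    (is "_ = ?R")
proof (rule set_eqI, rule iffI)
  fix K assume "K \<in> attachments m Q"
  then have sub: "K \<subseteq> Q \<times> ({m} \<times> UNIV)" and i1: "inj_on fst K" and i2: "inj_on snd K"
    by (auto simp: attachments_def)
  let ?part = "\<lambda>t. {c \<in> K. snd c = (m, t)}"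
  have part: "?part t = {} \<or> (\<exists>q\<in>Q. ?part t = {(q, (m, t))})" for t
  proof (cases "?part t = {}")
    case False
    then obtain c where c: "c \<in> K" "snd c = (m, t)" by blast
    have "c' = c" if "c' \<in> ?part t" for c'
      using inj_onD[OF i2, of c' c] that c by simp
    then have "?part t = {c}" using c by blast
    moreover have "c = (fst c, (m, t))" "fst c \<in> Q"
      using c sub by (auto simp: prod_eq_iff)
    ultimately show ?thesis by metis
  qed simp
  have K: "K = ?part First \<union> ?part Second"
  proof
    show "K \<subseteq> ?part First \<union> ?part Second"
    proof
      fix c assume c: "c \<in> K"
      then obtain t where "snd c = (m, t)" using sub by auto
      with c show "c \<in> ?part First \<union> ?part Second" by (cases t) auto
    qed
  qed auto
  consider "?part First = {}" "?part Second = {}"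
    | q where "q \<in> Q" "?part First = {(q, (m, First))}" "?part Second = {}"
    | r where "r \<in> Q" "?part First = {}" "?part Second = {(r, (m, Second))}"
    | q r where "q \<in> Q" "r \<in> Q" "?part First = {(q, (m, First))}"
        "?part Second = {(r, (m, Second))}"
    using part[of First] part[of Second] by blast
  then show "K \<in> ?R"
  proof cases
    case 1
    then have "K = {}" by (subst K) (unfold 1, auto)
    then show ?thesis by blast
  next
    case (2 q)
    then have "K = {(q, (m, First))}" by (subst K) (unfold 2(2,3), auto)
    then show ?thesis using 2 by (intro insertI2 UnI1) force
  next
    case (3 r)
    then have "K = {(r, (m, Second))}" by (subst K) (unfold 3(2,3), auto)
    then show ?thesis using 3 by (intro insertI2 UnI1) force
  next
    case (4 q r)
    then have Kqr: "K = {(q, (m, First)), (r, (m, Second))}" by (subst K) (unfold 4(3,4), auto)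
    have "q \<noteq> r"
    proof
      assume "q = r"
      then have "(q, (m, First)) = (r, (m, Second))"
        by (intro inj_onD[OF i1]) (use Kqr in auto)
      then show False by simp
    qed
    then show ?thesis using 4 Kqr by (intro insertI2 UnI2) force
  qed
next
  fix K assume "K \<in> ?R"
  then show "K \<in> attachments m Q"
    by (auto simp: attachments_def inj_on_def)
qed

lemma finite_attachments: "finite Q \<Longrightarrow> finite (attachments m Q)"
  by (simp add: attachments_eq UNIV_side)

text \<open>With \<open>a\<close> available outputs there are \<open>1\<close>, \<open>2a\<close> and \<open>a(a - 1)\<close> ways to use \<open>0\<close>, \<open>1\<close> and
  \<open>2\<close> of them, as in
  \<open>D\<^sup>2 X\<^sup>a = X\<^sup>a D\<^sup>2 + 2a X\<^bsup>a-1\<^esup> D + a(a - 1) X\<^bsup>a-2\<^esup>\<close>.\<close>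

lemma sum_attachments:
  fixes f :: "nat \<Rightarrow> 'a::comm_semiring_1"
  assumes "finite Q"
  shows "(\<Sum>K\<in>attachments m Q. f (card K)) =
    f 0 + of_nat (2 * card Q) * f 1 + of_nat (card Q * (card Q - 1)) * f 2"
proof -
  let ?one = "\<lambda>(q :: slot, t :: side). {(q, (m, t))}"
    and ?two = "\<lambda>(q :: slot, r :: slot). {(q, (m, First)), (r, (m, Second))}"
  let ?P = "SIGMA q:Q. Q - {q}"
  have fin: "finite (Q \<times> (UNIV :: side set))" "finite ?P"
    using assms by (auto simp: UNIV_side)
  have inj1: "inj_on ?one (Q \<times> UNIV)" by (auto simp: inj_on_def)
  have inj2: "inj_on ?two ?P" by (auto simp: inj_on_def doubleton_eq_iff)
  have card2: "card ?P = card Q * (card Q - 1)"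
    using assms by (simp add: card_SigmaI)
  have disj: "?one ` (Q \<times> UNIV) \<inter> ?two ` ?P = {}"
    by (auto simp: doubleton_eq_iff)
  have "(\<Sum>K\<in>attachments m Q. f (card K)) =
      f (card {}) + (\<Sum>K\<in>?one ` (Q \<times> UNIV) \<union> ?two ` ?P. f (card K))"
    unfolding attachments_eq by (subst sum.insert) (use fin in auto)
  also have "(\<Sum>K\<in>?one ` (Q \<times> UNIV) \<union> ?two ` ?P. f (card K)) =
      (\<Sum>K\<in>?one ` (Q \<times> UNIV). f (card K)) + (\<Sum>K\<in>?two ` ?P. f (card K))"
    by (subst sum.union_disjoint) (use fin disj in auto)
  also have "(\<Sum>K\<in>?one ` (Q \<times> UNIV). f (card K)) = (\<Sum>x\<in>Q \<times> (UNIV :: side set). f 1)"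
    unfolding sum.reindex[OF inj1] by (intro sum.cong) auto
  also have "\<dots> = of_nat (2 * card Q) * f 1"
    by (simp add: card_cartesian_product UNIV_side mult_2_right distrib_left mult.commute)
  also have "(\<Sum>K\<in>?two ` ?P. f (card K)) = (\<Sum>x\<in>?P. f 2)"
    unfolding sum.reindex[OF inj2] by (intro sum.cong) (auto simp: numeral_2_eq_2)
  also have "\<dots> = of_nat (card Q * (card Q - 1)) * f 2"
    by (simp add: card2)
  finally show ?thesis by (simp add: add.assoc)
qed

section \<open>Appending a node to a diagram\<close>

text \<open>Removal of all nodes beyond \<open>n\<close>. Connections go from smaller to larger labels, so those that
  survive are exactly those whose input slot survives.\<close>

definition truncate_diagram :: "nat \<Rightarrow> diagram \<Rightarrow> diagram" where
  "truncate_diagram n d = (restrict (fst d) {1..n}, {c \<in> snd d. fst (snd c) \<le> n})"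

lemma labelled_diagramsD:
  assumes "(g, C) \<in> labelled_diagrams n"
  shows "g \<in> {1..n} \<rightarrow>\<^sub>E UNIV" "C \<subseteq> output_slots n g \<times> input_slots n g"
    "\<And>p q. (p, q) \<in> C \<Longrightarrow> fst p < fst q" "inj_on fst C" "inj_on snd C"
  using assms by (fastforce simp: labelled_diagrams_def)+

lemma labelled_diagramsI:
  assumes "g \<in> {1..n} \<rightarrow>\<^sub>E UNIV" "C \<subseteq> output_slots n g \<times> input_slots n g"
    "\<And>p q. (p, q) \<in> C \<Longrightarrow> fst p < fst q" "inj_on fst C" "inj_on snd C"
  shows "(g, C) \<in> labelled_diagrams n"
  using assms by (fastforce simp: labelled_diagrams_def)

lemma truncate_diagram_in:
  assumes "d \<in> labelled_diagrams (Suc n)"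
  shows "truncate_diagram n d \<in> labelled_diagrams n"
proof -
  obtain g C where d: "d = (g, C)" by (cases d)
  note D = labelled_diagramsD[OF assms[unfolded d]]
  show ?thesis
    unfolding truncate_diagram_def d fst_conv snd_conv
  proof (rule labelled_diagramsI)
    show "{c \<in> C. fst (snd c) \<le> n} \<subseteq>
        output_slots n (restrict g {1..n}) \<times> input_slots n (restrict g {1..n})"
    proof
      fix c assume c: "c \<in> {c \<in> C. fst (snd c) \<le> n}"
      obtain i s j t where [simp]: "c = ((i, s), (j, t))" by (metis surj_pair)
      from c D(2) D(3)[of "(i, s)" "(j, t)"]
      show "c \<in> output_slots n (restrict g {1..n}) \<times> input_slots n (restrict g {1..n})"
        by (auto simp: output_slots_def input_slots_def)
    qed
  qed (use D in \<open>auto intro: inj_on_subset\<close>)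
qed

lemma output_slots_upd:
  "output_slots (Suc n) (g(Suc n := X2_gate)) = output_slots n g \<union> {Suc n} \<times> UNIV"
  "output_slots (Suc n) (g(Suc n := D2_gate)) = output_slots n g"
  by (auto simp: output_slots_def le_Suc_eq)

lemma input_slots_upd:
  "input_slots (Suc n) (g(Suc n := X2_gate)) = input_slots n g"
  "input_slots (Suc n) (g(Suc n := D2_gate)) = input_slots n g \<union> {Suc n} \<times> UNIV"
  by (auto simp: input_slots_def le_Suc_eq)

lemma slot_index_le:
  "p \<in> output_slots n g \<Longrightarrow> fst p \<le> n" "p \<in> input_slots n g \<Longrightarrow> fst p \<le> n"
  by (auto simp: output_slots_def input_slots_def)

text \<open>A last \<open>X\<^sup>2\<close>-node can only contribute free outputs, since nothing comes after it; a last
  \<open>D\<^sup>2\<close>-node may consume outputs of the diagram before it, and the choice of an attachment is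
  the only freedom.\<close>

lemma truncate_fibre:
  assumes "(g, C) \<in> labelled_diagrams n"
  shows "{d \<in> labelled_diagrams (Suc n). truncate_diagram n d = (g, C)} =
    insert (g(Suc n := X2_gate), C)
      ((\<lambda>K. (g(Suc n := D2_gate), C \<union> K)) ` attachments (Suc n) (diagram_outputs n (g, C)))"
    (is "?L = insert ?x (?D ` ?A)")
proof (rule set_eqI, rule iffI)
  note D = labelled_diagramsD[OF assms]
  fix d assume "d \<in> ?L"
  then obtain g' C' where d: "d = (g', C')" and d': "(g', C') \<in> labelled_diagrams (Suc n)"
    and gr: "restrict g' {1..n} = g" and CC: "{c \<in> C'. fst (snd c) \<le> n} = C"
    by (cases d) (auto simp: truncate_diagram_def)
  note D' = labelled_diagramsD[OF d']
  have g': "g' = g(Suc n := g' (Suc n))"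
  proof
    fix j
    consider "j \<in> {1..n}" | "j = Suc n" | "j \<notin> {1..Suc n}"
      by (auto simp: le_Suc_eq)
    then show "g' j = (g(Suc n := g' (Suc n))) j"
    proof cases
      case 1
      then show ?thesis unfolding gr[symmetric] by simp
    next
      case 3
      then show ?thesis using PiE_arb[OF D'(1), of j] PiE_arb[OF D(1), of j] by auto
    qed simp
  qed
  show "d \<in> insert ?x (?D ` ?A)"
  proof (cases "g' (Suc n)")
    case X2_gate
    have "fst (snd c) \<le> n" if "c \<in> C'" for c
    proof -
      have "snd c \<in> input_slots n g"
        using D'(2) that g' X2_gate input_slots_upd(1)[of n g] by fastforce
      then show ?thesis by (rule slot_index_le)
    qed
    then have "C' = C" using CC by auto
    then show ?thesis using d g' X2_gate by simp
  next
    case D2_gate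
    let ?K = "{c \<in> C'. fst (snd c) = Suc n}"
    have split: "fst c \<in> output_slots n g \<and> snd c \<in> input_slots n g \<union> {Suc n} \<times> UNIV"
      if "c \<in> C'" for c
      using D'(2) that g' D2_gate input_slots_upd(2)[of n g] output_slots_upd(2)[of n g]
      by (metis mem_Times_iff subsetD)
    have "fst (snd c) \<le> n \<or> fst (snd c) = Suc n" if "c \<in> C'" for c
      using split[OF that] slot_index_le(2)[of "snd c" n g] by auto
    then have C': "C' = C \<union> ?K" using CC by blast
    have "?K \<subseteq> diagram_outputs n (g, C) \<times> ({Suc n} \<times> UNIV)"
    proof
      fix c assume c: "c \<in> ?K"
      have "fst c \<notin> fst ` C"
      proof
        assume "fst c \<in> fst ` C"
        then obtain c' where c': "c' \<in> C" "fst c' = fst c" by force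
        then have "c' = c" using inj_onD[OF D'(4)] CC c by blast
        then show False using c' CC c by auto
      qed
      then show "c \<in> diagram_outputs n (g, C) \<times> ({Suc n} \<times> UNIV)"
        using split[of c] c by (auto simp: diagram_outputs_def mem_Times_iff)
    qed
    then have "?K \<in> ?A"
      using D'(4,5) by (auto simp: attachments_def intro: inj_on_subset)
    moreover have "d = ?D ?K"
    proof -
      have "g' = g(Suc n := D2_gate)" by (subst g') (simp only: D2_gate)
      then show ?thesis unfolding d by (simp only: C'[symmetric])
    qed
    ultimately show ?thesis by (intro insertI2 image_eqI)
  qed
next
  note D = labelled_diagramsD[OF assms]
  have g0: "g(Suc n := y) \<in> {1..Suc n} \<rightarrow>\<^sub>E UNIV" for y
    using D(1) by (auto simp: PiE_iff extensional_def)
  have gr: "restrict (g(Suc n := y)) {1..n} = g" for y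
  proof
    fix j
    show "restrict (g(Suc n := y)) {1..n} j = g j"
      using PiE_arb[OF D(1), of j] by (cases "j \<in> {1..n}") auto
  qed
  have Cn: "fst (snd c) \<le> n" if "c \<in> C" for c
    using D(2) slot_index_le(2) that by fastforce
  fix d assume "d \<in> insert ?x (?D ` ?A)"
  then consider "d = ?x" | K where "d = ?D K" "K \<in> ?A" by blast
  then show "d \<in> ?L"
  proof cases
    case 1
    have "?x \<in> labelled_diagrams (Suc n)"
      by (rule labelled_diagramsI) (use D g0 in \<open>auto simp: output_slots_upd input_slots_upd\<close>)
    moreover have "truncate_diagram n ?x = (g, C)"
      using Cn gr by (auto simp: truncate_diagram_def)
    ultimately show ?thesis using 1 by simp
  next
    case 2
    then have K: "K \<subseteq> diagram_outputs n (g, C) \<times> ({Suc n} \<times> UNIV)" "inj_on fst K" "inj_on snd K"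
      by (auto simp: attachments_def)
    have Kn: "fst p < fst q \<and> fst q = Suc n" if "(p, q) \<in> K" for p q
    proof -
      have "p \<in> output_slots n g" using K(1) that by (auto simp: diagram_outputs_def)
      from slot_index_le(1)[OF this] K(1) that show ?thesis by auto
    qed
    have Kn': "fst (snd c) = Suc n" if "c \<in> K" for c
      using Kn[of "fst c" "snd c"] that by simp
    have KC: "fst c \<notin> fst ` C" "snd c \<notin> snd ` C" if "c \<in> K" for c
    proof -
      have "fst c \<in> diagram_outputs n (g, C)"
        using subsetD[OF K(1) that] by (simp add: mem_Times_iff)
      then show "fst c \<notin> fst ` C" by (simp add: diagram_outputs_def)
      show "snd c \<notin> snd ` C"
        using Cn Kn'[OF that] by (metis Suc_n_not_le_n imageE)
    qed
    have disj: "fst ` K \<inter> fst ` C = {}" "snd ` K \<inter> snd ` C = {}"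
      using KC by blast+
    have "?D K \<in> labelled_diagrams (Suc n)"
    proof (rule labelled_diagramsI)
      show "C \<union> K \<subseteq> output_slots (Suc n) (g(Suc n := D2_gate)) \<times>
          input_slots (Suc n) (g(Suc n := D2_gate))"
        using D(2) K(1) by (auto simp: output_slots_upd input_slots_upd diagram_outputs_def)
      show "inj_on fst (C \<union> K)" "inj_on snd (C \<union> K)"
        unfolding inj_on_Un using D(4,5) K(2,3) disj by blast+
      show "fst p < fst q" if "(p, q) \<in> C \<union> K" for p q
        using that D(3) Kn by blast
    qed (rule g0)
    moreover have "truncate_diagram n (?D K) = (g, C)"
    proof -
      have "{c \<in> C \<union> K. fst (snd c) \<le> n} = C"
        using Cn Kn' by fastforce
      then show ?thesis by (simp only: truncate_diagram_def gr fst_conv snd_conv)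
    qed
    ultimately show ?thesis using 2 by simp
  qed
qed

definition num_outputs :: "nat \<Rightarrow> diagram \<Rightarrow> nat" where
  "num_outputs n d = card (diagram_outputs n d)"

definition num_inputs :: "nat \<Rightarrow> diagram \<Rightarrow> nat" where
  "num_inputs n d = card (diagram_inputs n d)"

lemma num_extend_X2:
  assumes "(g, C) \<in> labelled_diagrams n"
  shows "num_outputs (Suc n) (g(Suc n := X2_gate), C) = num_outputs n (g, C) + 2"
    "num_inputs (Suc n) (g(Suc n := X2_gate), C) = num_inputs n (g, C)"
proof -
  note D = labelled_diagramsD[OF assms]
  have "diagram_outputs (Suc n) (g(Suc n := X2_gate), C) =
      diagram_outputs n (g, C) \<union> {Suc n} \<times> UNIV"
    using D(2) slot_index_le(1)[of _ n g]
    by (fastforce simp: diagram_outputs_def output_slots_upd)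
  moreover have "diagram_outputs n (g, C) \<inter> {Suc n} \<times> UNIV = {}"
    using slot_index_le(1)[of _ n g] by (fastforce simp: diagram_outputs_def)
  ultimately show "num_outputs (Suc n) (g(Suc n := X2_gate), C) = num_outputs n (g, C) + 2"
    unfolding num_outputs_def
    by (metis card_Un_disjoint card_node_slots finite_node_slots diagram_outputs_def
        finite_Diff finite_slots(1))
  show "num_inputs (Suc n) (g(Suc n := X2_gate), C) = num_inputs n (g, C)"
    by (simp add: num_inputs_def diagram_inputs_def input_slots_upd)
qed

lemma num_extend_D2:
  assumes "(g, C) \<in> labelled_diagrams n"
    and "K \<in> attachments (Suc n) (diagram_outputs n (g, C))"
  shows "num_outputs (Suc n) (g(Suc n := D2_gate), C \<union> K) = num_outputs n (g, C) - card K"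
    "num_inputs (Suc n) (g(Suc n := D2_gate), C \<union> K) = num_inputs n (g, C) + (2 - card K)"
proof -
  note D = labelled_diagramsD[OF assms(1)]
  have K: "K \<subseteq> diagram_outputs n (g, C) \<times> ({Suc n} \<times> UNIV)" "inj_on fst K" "inj_on snd K"
    using assms(2) by (auto simp: attachments_def)
  have fin: "finite (diagram_outputs n (g, C))" "finite (diagram_inputs n (g, C))"
    by (auto simp: diagram_outputs_def diagram_inputs_def finite_slots)
  have finK: "finite K"
    by (rule finite_subset[OF K(1)]) (intro finite_cartesian_product fin finite_node_slots)
  have "diagram_outputs (Suc n) (g(Suc n := D2_gate), C \<union> K) = diagram_outputs n (g, C) - fst ` K"
    by (auto simp: diagram_outputs_def output_slots_upd)
  moreover have "card (diagram_outputs n (g, C) - fst ` K) = num_outputs n (g, C) - card (fst ` K)"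
    unfolding num_outputs_def by (rule card_Diff_subset) (use K finK in auto)
  ultimately show "num_outputs (Suc n) (g(Suc n := D2_gate), C \<union> K) = num_outputs n (g, C) - card K"
    using K(2) by (simp add: num_outputs_def card_image)
  have sK: "snd ` K \<subseteq> {Suc n} \<times> UNIV" using K(1) by auto
  have disj: "p \<notin> {Suc n} \<times> UNIV" if "p \<in> input_slots n g" for p
    using slot_index_le(2)[OF that] by auto
  have sC: "snd ` C \<subseteq> input_slots n g" using D(2) by auto
  have split: "(A \<union> B) - (X \<union> Y) = (A - X) \<union> (B - Y)"
    if "X \<subseteq> A" "Y \<subseteq> B" "A \<inter> B = {}" for A B X Y :: "slot set"
    using that by blast
  have "diagram_inputs (Suc n) (g(Suc n := D2_gate), C \<union> K) =
      diagram_inputs n (g, C) \<union> ({Suc n} \<times> UNIV - snd ` K)"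
    unfolding diagram_inputs_def input_slots_upd fst_conv snd_conv image_Un
    by (rule split[OF sC sK]) (use disj in auto)
  moreover have "diagram_inputs n (g, C) \<inter> ({Suc n} \<times> UNIV - snd ` K) = {}"
    using disj by (auto simp: diagram_inputs_def)
  moreover have "card ({Suc n} \<times> UNIV - snd ` K) = 2 - card K"
    using card_Diff_subset[OF _ sK] finK K(3) by (simp add: card_node_slots card_image)
  ultimately show "num_inputs (Suc n) (g(Suc n := D2_gate), C \<union> K) = num_inputs n (g, C) + (2 - card K)"
    unfolding num_inputs_def using fin(2) finite_node_slots
    by (metis card_Un_disjoint finite_Diff)
qed

text \<open>The effect of the last node on any statistic of the pair (outputs, inputs): sort the diagrams
  of size \<open>n + 1\<close> by what is left when that node is removed. For \<open>a < 2\<close> the truncated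
  subtractions are harmless, as their coefficients vanish.\<close>

lemma sum_labelled_diagrams_Suc:
  fixes f :: "nat \<Rightarrow> nat \<Rightarrow> 'a::comm_semiring_1"
  shows "(\<Sum>d\<in>labelled_diagrams (Suc n). f (num_outputs (Suc n) d) (num_inputs (Suc n) d)) =
    (\<Sum>d\<in>labelled_diagrams n. let a = num_outputs n d; b = num_inputs n d in
       f (a + 2) b + f a (b + 2) + of_nat (2 * a) * f (a - 1) (b + 1)
       + of_nat (a * (a - 1)) * f (a - 2) b)"
    (is "sum ?F _ = sum ?G _")
proof -
  have "sum ?F (labelled_diagrams (Suc n)) =
      (\<Sum>d\<in>labelled_diagrams n. sum ?F {d' \<in> labelled_diagrams (Suc n). truncate_diagram n d' = d})"
    by (rule sum.group[symmetric])
      (use truncate_diagram_in in \<open>auto simp: finite_labelled_diagrams\<close>)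
  also have "\<dots> = sum ?G (labelled_diagrams n)"
  proof (rule sum.cong[OF refl])
    fix d assume d: "d \<in> labelled_diagrams n"
    obtain g C where gC: "d = (g, C)" by (cases d)
    note L = d[unfolded gC]
    let ?A = "attachments (Suc n) (diagram_outputs n (g, C))"
    let ?x = "(g(Suc n := X2_gate), C)" and ?D = "\<lambda>K. (g(Suc n := D2_gate), C \<union> K)"
    let ?a = "num_outputs n d" and ?b = "num_inputs n d"
    have fin: "finite (diagram_outputs n (g, C))"
      by (auto simp: diagram_outputs_def finite_slots)
    have xD: "?x \<notin> ?D ` ?A"
      by (auto dest: fun_cong[of _ _ "Suc n"])
    have new: "{c \<in> C \<union> K. fst (snd c) = Suc n} = K" if "K \<in> ?A" for K
      using that labelled_diagramsD(2)[OF L] slot_index_le(2)[of _ n g]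
      by (fastforce simp: attachments_def)
    have inj: "inj_on ?D ?A"
    proof (rule inj_onI)
      fix K K' assume "K \<in> ?A" "K' \<in> ?A" "?D K = ?D K'"
      then show "K = K'" using new[of K] new[of K'] by simp
    qed
    have "sum ?F {d' \<in> labelled_diagrams (Suc n). truncate_diagram n d' = d} =
        ?F ?x + sum ?F (?D ` ?A)"
      unfolding gC truncate_fibre[OF L]
      by (subst sum.insert) (use xD finite_attachments[OF fin] in auto)
    also have "sum ?F (?D ` ?A) = (\<Sum>K\<in>?A. f (?a - card K) (?b + (2 - card K)))"
      unfolding sum.reindex[OF inj]
      by (rule sum.cong) (use num_extend_D2[OF L] gC in auto)
    also have "\<dots> = f ?a (?b + 2) + of_nat (2 * ?a) * f (?a - 1) (?b + 1)
        + of_nat (?a * (?a - 1)) * f (?a - 2) ?b"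
      unfolding sum_attachments[OF fin, of "\<lambda>k. f (?a - k) (?b + (2 - k))"]
      by (simp add: gC num_outputs_def)
    also have "?F ?x = f (?a + 2) ?b"
      using num_extend_X2[OF L] gC by simp
    finally show "sum ?F {d' \<in> labelled_diagrams (Suc n). truncate_diagram n d' = d} = ?G d"
      by (simp add: Let_def add.assoc)
  qed
  finally show ?thesis .
qed

section \<open>Counting by outputs\<close>

text \<open>Only the number of outputs has to be tracked as a separate index, since the recurrence
  differentiates in the variable for outputs but merely multiplies by powers of the variable for
  inputs. The latter can thus be a fixed scalar \<open>v\<close> from the start.\<close>

definition output_weight :: "'a::comm_semiring_1 \<Rightarrow> nat \<Rightarrow> nat \<Rightarrow> 'a" where
  "output_weight v n a =
     (\<Sum>d\<in>labelled_diagrams n. if num_outputs n d = a then v ^ num_inputs n d else 0)"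

lemma output_weight_0: "output_weight v 0 a = (if a = 0 then 1 else 0)"
proof -
  have "labelled_diagrams 0 = {(\<lambda>_. undefined, {})}"
    by (auto simp: labelled_diagrams_def output_slots_def)
  then show ?thesis
    by (simp add: output_weight_def num_outputs_def num_inputs_def diagram_outputs_def
        diagram_inputs_def output_slots_def input_slots_def)
qed

lemma output_weight_Suc:
  "output_weight v (Suc n) a =
     (if a < 2 then 0 else output_weight v n (a - 2)) + v ^ 2 * output_weight v n a
     + of_nat (2 * (a + 1)) * v * output_weight v n (a + 1)
     + of_nat ((a + 2) * (a + 1)) * output_weight v n (a + 2)"
proof -
  have shift: "(if a < 2 then 0 else output_weight v n (a - 2)) =
      (\<Sum>d\<in>labelled_diagrams n. if num_outputs n d + 2 = a then v ^ num_inputs n d else 0)"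
    by (auto simp: output_weight_def intro!: sum.cong sum.neutral[symmetric])
  show ?thesis
    unfolding shift unfolding output_weight_def
      sum_labelled_diagrams_Suc[of "\<lambda>x b. if x = a then v ^ b else 0"]
      sum_distrib_left sum.distrib[symmetric]
  proof (intro sum.cong refl)
    fix d
    let ?x = "num_outputs n d" and ?b = "num_inputs n d"
    have "of_nat (2 * ?x) * (if ?x - 1 = a then v ^ (?b + 1) else 0) =
        of_nat (2 * (a + 1)) * v * (if ?x = a + 1 then v ^ ?b else 0)"
      by (cases "?x") (auto simp: mult.assoc simp del: of_nat_mult of_nat_Suc)
    moreover have "of_nat (?x * (?x - 1)) * (if ?x - 2 = a then v ^ ?b else 0) =
        of_nat ((a + 2) * (a + 1)) * (if ?x = a + 2 then v ^ ?b else 0)"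
    proof (cases "?x < 2")
      case True
      then have "?x * (?x - 1) = 0" "?x \<noteq> a + 2" by auto
      then show ?thesis by (simp del: mult_eq_0_iff)
    next
      case False
      then have "?x - 2 = a \<longleftrightarrow> ?x = a + 2" by auto
      then show ?thesis by (cases "?x = a + 2") (simp_all only: if_True if_False mult_zero_right, simp)
    qed
    ultimately show "(let x = ?x; b = ?b in
        (if x + 2 = a then v ^ b else 0) + (if x = a then v ^ (b + 2) else 0)
        + of_nat (2 * x) * (if x - 1 = a then v ^ (b + 1) else 0)
        + of_nat (x * (x - 1)) * (if x - 2 = a then v ^ b else 0)) =
      (if ?x + 2 = a then v ^ ?b else 0) + v ^ 2 * (if ?x = a then v ^ ?b else 0)
        + of_nat (2 * (a + 1)) * v * (if ?x = a + 1 then v ^ ?b else 0)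
        + of_nat ((a + 2) * (a + 1)) * (if ?x = a + 2 then v ^ ?b else 0)"
      by (simp add: Let_def power_add power2_eq_square mult_ac)
  qed
qed

lemma num_inputs_le: "num_inputs n d \<le> 2 * n"
proof -
  have "card (diagram_inputs n d) \<le> card ({1..n} \<times> {First, Second})"
    unfolding diagram_inputs_def by (intro card_mono) (use slots_subset(2) in blast)+
  then show ?thesis by (simp add: num_inputs_def card_cartesian_product)
qed

lemma sum_diagram_count:
  "(\<Sum>b\<le>2 * n. of_nat (diagram_count n a b) * v ^ b) = output_weight v n a"
proof -
  let ?S = "{d \<in> labelled_diagrams n. num_outputs n d = a}"
  have "output_weight v n a = (\<Sum>d\<in>?S. v ^ num_inputs n d)"
    unfolding output_weight_def by (simp add: sum.If_cases finite_labelled_diagrams Int_def conj_commute)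
  also have "\<dots> = (\<Sum>b\<le>2 * n. \<Sum>d\<in>{d \<in> ?S. num_inputs n d = b}. v ^ num_inputs n d)"
    by (rule sum.group[symmetric]) (use num_inputs_le in \<open>auto simp: finite_labelled_diagrams\<close>)
  also have "\<dots> = (\<Sum>b\<le>2 * n. of_nat (diagram_count n a b) * v ^ b)"
    by (intro sum.cong)
      (auto simp: diagram_count_def num_outputs_def num_inputs_def conj_assoc)
  finally show ?thesis by simp
qed

section \<open>Exponentials of power series, expanded in a parameter\<close>

lemma fps_linear_ode_unique:
  fixes f g q :: "'a::field_char_0 fps"
  assumes "fps_deriv f = q * f" "fps_deriv g = q * g" "fps_nth f 0 = fps_nth g 0"
  shows "f = g"
proof (rule fps_ext)
  fix n show "fps_nth f n = fps_nth g n"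
  proof (induction n rule: less_induct)
    case (less n)
    show ?case
    proof (cases n)
      case (Suc m)
      have "of_nat (Suc m) * fps_nth f (Suc m) = of_nat (Suc m) * fps_nth g (Suc m)"
        using arg_cong[OF assms(1), of "\<lambda>h. fps_nth h m"]
          arg_cong[OF assms(2), of "\<lambda>h. fps_nth h m"] less Suc
        by (simp add: fps_mult_nth)
      then show ?thesis using Suc by (simp del: of_nat_Suc)
    qed (use assms in simp)
  qed
qed

text \<open>The coefficients of \<open>exp (u\<^sup>2 T / 2 + u B)\<close> as a power series in \<open>u\<close>, with the index shifted
  by two: \<open>exp_coeff T B (a + 2)\<close> belongs to \<open>u\<^sup>a\<close>. The two leading zeros make the
  recurrence and the derivative formula below hold for every \<open>a\<close> without boundary cases.
  Since \<open>u\<close> is an element of the field, not a formal variable, differentiation in \<open>u\<close> is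
  available only through these coefficients.\<close>

fun exp_coeff :: "'a::field_char_0 fps \<Rightarrow> 'a fps \<Rightarrow> nat \<Rightarrow> 'a fps" where
  "exp_coeff T B 0 = 0"
| "exp_coeff T B (Suc 0) = 0"
| "exp_coeff T B (Suc (Suc 0)) = 1"
| "exp_coeff T B (Suc (Suc (Suc a))) =
     fps_const (1 / of_nat (Suc a)) * (B * exp_coeff T B (Suc (Suc a)) + T * exp_coeff T B (Suc a))"

text \<open>This is \<open>\<partial>E/\<partial>u = (B + u T) E\<close> for \<open>E = exp (u\<^sup>2 T / 2 + u B)\<close>, read off coefficientwise.\<close>

lemma exp_coeff_rec:
  "of_nat a * exp_coeff T B (a + 2) = B * exp_coeff T B (a + 1) + T * exp_coeff T B a"
proof (cases a)
  case (Suc k)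
  have "of_nat (Suc k) * fps_const (1 / of_nat (Suc k)) = (1 :: 'a fps)"
    by (simp add: fps_of_nat[symmetric] del: of_nat_Suc)
  then show ?thesis using Suc by (simp add: mult.assoc[symmetric] del: of_nat_Suc)
qed simp

lemma of_nat_fps_cancel:
  fixes f g :: "'a::field_char_0 fps"
  assumes "of_nat (Suc k) * f = of_nat (Suc k) * g"
  shows "f = g"
  using assms by (simp del: of_nat_Suc)

text \<open>This is \<open>E' = (u\<^sup>2 T' / 2 + u B') E\<close>, where the derivative is in \<open>z\<close>. The induction
  differentiates the recurrence and uses it again to collect the terms.\<close>

lemma fps_deriv_exp_coeff:
  "fps_deriv (exp_coeff T B (a + 2)) =
     fps_const (1 / 2) * fps_deriv T * exp_coeff T B a + fps_deriv B * exp_coeff T B (a + 1)"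
proof (induction a rule: less_induct)
  case (less a)
  let ?e = "exp_coeff T B" and ?h = "fps_const (1 / 2) :: 'a fps"
  have half: "?h + ?h = 1" by simp
  show ?case
  proof (cases a)
    case (Suc k)
    note rec0 = exp_coeff_rec[of "Suc k" T B]
    have d1: "fps_deriv (?e (k + 2)) = ?h * fps_deriv T * ?e k + fps_deriv B * ?e (k + 1)"
      using less Suc by simp
    \<comment> \<open>For \<open>k = 0\<close>, where \<open>k - 1\<close> is truncated, \<open>d0\<close> and \<open>r0\<close> hold because \<open>?e 0 = ?e 1 = 0\<close>.\<close>
    have d0: "fps_deriv (?e (k + 1)) = ?h * fps_deriv T * ?e (k - 1) + fps_deriv B * ?e k"
      using less.IH[of "k - 1"] Suc by (cases k) auto
    have r1: "of_nat k * ?e (k + 2) = B * ?e (k + 1) + T * ?e k"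
      by (rule exp_coeff_rec)
    have r0: "of_nat k * ?e (k + 1) = B * ?e k + T * ?e (k - 1) + ?e (k + 1)"
      using exp_coeff_rec[of "k - 1" T B] by (cases k) (auto simp: algebra_simps)
    have "of_nat (Suc k) * fps_deriv (?e (Suc k + 2)) = fps_deriv (of_nat (Suc k) * ?e (Suc k + 2))"
      by simp
    also have "\<dots> = fps_deriv B * ?e (k + 2) + B * fps_deriv (?e (k + 2))
        + (fps_deriv T * ?e (k + 1) + T * fps_deriv (?e (k + 1)))"
      unfolding rec0 by (simp add: algebra_simps)
    also have "\<dots> = of_nat (Suc k) * (?h * fps_deriv T * ?e (Suc k) + fps_deriv B * ?e (Suc k + 1))"
    proof -
      \<comment> \<open>The last summand vanishes; it splits \<open>T'\<close> into its two halves.\<close>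
      have "fps_deriv B * ?e (k + 2) + B * fps_deriv (?e (k + 2))
          + (fps_deriv T * ?e (k + 1) + T * fps_deriv (?e (k + 1))) =
        fps_deriv B * (?e (k + 2) + (B * ?e (k + 1) + T * ?e k))
          + ?h * fps_deriv T * (B * ?e k + T * ?e (k - 1) + ?e (k + 1) + ?e (k + 1))
          + (1 - (?h + ?h)) * fps_deriv T * ?e (k + 1)"
        unfolding d0 d1 by (simp only: algebra_simps mult_1_left)
      also have "\<dots> = fps_deriv B * (?e (k + 2) + of_nat k * ?e (k + 2))
          + ?h * fps_deriv T * (of_nat k * ?e (k + 1) + ?e (k + 1))"
        unfolding r1 r0 half by simp
      finally show ?thesis by (simp add: algebra_simps)
    qed
    finally show ?thesis using Suc of_nat_fps_cancel by blast
  qed simp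
qed

lemma fps_mult_nth_eq_0:
  fixes f g :: "'a::comm_semiring_1 fps"
  assumes "fps_nth f 0 = 0" "\<And>i. i < n \<Longrightarrow> fps_nth g i = 0"
  shows "fps_nth (f * g) n = 0"
  unfolding fps_mult_nth
proof (intro sum.neutral ballI)
  fix i assume "i \<in> {0..n}"
  then show "fps_nth f i * fps_nth g (n - i) = 0"
    using assms by (cases "i = 0") auto
qed

text \<open>\<open>T\<close> and \<open>B\<close> start with \<open>z\<close> or later, and each of them accounts for at most two powers of
  \<open>u\<close>, so \<open>u\<^sup>a\<close> comes with at least \<open>a / 2\<close> powers of \<open>z\<close>. This is what makes the sum over
  \<open>a\<close> finite in each coefficient of \<open>z\<close>. The shift of the index accounts for the \<open>2\<close> in the bound.\<close>

lemma exp_coeff_nth_eq_0: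
  assumes "fps_nth T 0 = 0" "fps_nth B 0 = 0" "2 * n + 2 < a"
  shows "fps_nth (exp_coeff T B a) n = 0"
  using assms(3)
proof (induction a arbitrary: n rule: less_induct)
  case (less a)
  define k where "k = a - 3"
  then have k: "a = Suc (Suc (Suc k))" using less.prems by simp
  have "fps_nth (B * exp_coeff T B (Suc (Suc k))) n = 0" "fps_nth (T * exp_coeff T B (Suc k)) n = 0"
    by (rule fps_mult_nth_eq_0; use assms less k in simp)+
  then show ?case by (simp add: k)
qed

text \<open>The coefficient of \<open>u\<^sup>a\<close> in the differential equation of the generating function, after
  division by the factor that is free of \<open>u\<close>; the term with the sum \<open>T + \<dots>\<close> on the left is the
  logarithmic derivative of that factor. The hypotheses are what \<open>T = tan 2z\<close> and
  \<open>B = V (sec 2z - 1)\<close> satisfy, the third one coming from \<open>sec\<^sup>2 = 1 + tan\<^sup>2\<close>. On the right, lowering the index by two is multiplication by \<open>u\<^sup>2\<close>, and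
  the last three terms are \<open>(V + \<partial>/\<partial>u)\<^sup>2\<close>.\<close>

lemma exp_coeff_heat:
  fixes V :: "'a::field_char_0 fps"
  assumes dT: "fps_deriv T = 2 * (1 + T ^ 2)" and dB: "fps_deriv B = 2 * T * (B + V)"
    and sq: "(B + V) ^ 2 = V ^ 2 * (1 + T ^ 2)"
  shows "fps_deriv (exp_coeff T B (a + 2)) + (T + V ^ 2 * (1 + T ^ 2)) * exp_coeff T B (a + 2) =
    exp_coeff T B a + V ^ 2 * exp_coeff T B (a + 2) + of_nat (2 * (a + 1)) * V * exp_coeff T B (a + 3)
    + of_nat ((a + 2) * (a + 1)) * exp_coeff T B (a + 4)"
proof -
  let ?e = "exp_coeff T B"
  define x where "x = (of_nat a :: 'a fps)"
  have "fps_const (1 / 2) * 2 = (1 :: 'a fps)"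
    by (simp add: numeral_fps_const)
  then have half: "fps_const (1 / 2) * fps_deriv T = 1 + T ^ 2"
    unfolding dT by (simp only: mult.assoc[symmetric] mult_1)
  have r: "x * ?e (a + 2) = B * ?e (a + 1) + T * ?e a"
    "(x + 1) * ?e (a + 3) = B * ?e (a + 2) + T * ?e (a + 1)"
    "(x + 2) * ?e (a + 4) = B * ?e (a + 3) + T * ?e (a + 2)"
    using exp_coeff_rec[of a T B] exp_coeff_rec[of "a + 1" T B] exp_coeff_rec[of "a + 2" T B]
    by (simp_all add: x_def numeral_eq_Suc add_ac del: exp_coeff.simps)
  have "of_nat (2 * (a + 1)) * V * ?e (a + 3) + of_nat ((a + 2) * (a + 1)) * ?e (a + 4)
      = 2 * V * ((x + 1) * ?e (a + 3)) + (x + 1) * ((x + 2) * ?e (a + 4))"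
    by (simp add: x_def algebra_simps)
  also have "\<dots> = (2 * V + B) * ((x + 1) * ?e (a + 3)) + T * (x * ?e (a + 2)) + T * ?e (a + 2)"
    unfolding r(3) by (simp add: algebra_simps)
  also have "\<dots> = (2 * V + B) * (B * ?e (a + 2) + T * ?e (a + 1))
      + T * (B * ?e (a + 1) + T * ?e a) + T * ?e (a + 2)"
    unfolding r(1,2) ..
  finally have "of_nat (2 * (a + 1)) * V * ?e (a + 3) + of_nat ((a + 2) * (a + 1)) * ?e (a + 4) =
    (2 * V + B) * (B * ?e (a + 2) + T * ?e (a + 1))
      + T * (B * ?e (a + 1) + T * ?e a) + T * ?e (a + 2)" by simp
  then show ?thesis
    unfolding fps_deriv_exp_coeff half dB sq[symmetric] by (simp add: algebra_simps power2_eq_square)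
qed

definition exp_partial :: "'a::field_char_0 fps \<Rightarrow> 'a fps \<Rightarrow> 'a \<Rightarrow> nat \<Rightarrow> 'a fps" where
  "exp_partial T B u N = (\<Sum>a\<le>N. fps_const (u ^ a) * exp_coeff T B (a + 2))"

lemma fps_deriv_exp_partial:
  "fps_deriv (exp_partial T B u (Suc (Suc N))) =
     fps_const (u ^ 2 / 2) * fps_deriv T * exp_partial T B u N
     + fps_const u * fps_deriv B * exp_partial T B u (Suc N)"
proof -
  let ?e = "exp_coeff T B"
  have "fps_deriv (exp_partial T B u (Suc (Suc N))) =
     fps_const (1 / 2) * fps_deriv T * (\<Sum>a\<le>Suc (Suc N). fps_const (u ^ a) * ?e a)
     + fps_deriv B * (\<Sum>a\<le>Suc (Suc N). fps_const (u ^ a) * ?e (a + 1))"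
    unfolding exp_partial_def fps_deriv_sum sum_distrib_left sum.distrib[symmetric]
    by (intro sum.cong refl)
      (simp add: fps_deriv_exp_coeff[unfolded add_2_eq_Suc'] algebra_simps del: exp_coeff.simps(3,4))
  also have "(\<Sum>a\<le>Suc (Suc N). fps_const (u ^ a) * ?e a) = fps_const (u ^ 2) * exp_partial T B u N"
    unfolding exp_partial_def sum_distrib_left sum.atMost_Suc_shift
    by (simp add: power2_eq_square mult.assoc[symmetric] del: sum.atMost_Suc exp_coeff.simps(3,4))
  also have "(\<Sum>a\<le>Suc (Suc N). fps_const (u ^ a) * ?e (a + 1)) = fps_const u * exp_partial T B u (Suc N)"
    unfolding exp_partial_def sum_distrib_left sum.atMost_Suc_shift[of _ "Suc N"]
    by (simp add: mult.assoc[symmetric] del: sum.atMost_Suc exp_coeff.simps(3,4))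
  finally have deriv: "fps_deriv (exp_partial T B u (Suc (Suc N))) =
      fps_const (1 / 2) * fps_deriv T * (fps_const (u ^ 2) * exp_partial T B u N)
      + fps_deriv B * (fps_const u * exp_partial T B u (Suc N))" .
  have half: "fps_const (u ^ 2 / 2) = fps_const (1 / 2) * fps_const (u ^ 2)" by simp
  show ?thesis unfolding deriv half by (simp only: mult_ac)
qed

lemma fps_mult_nth_cong:
  assumes "\<And>i. i \<le> n \<Longrightarrow> fps_nth f i = fps_nth g i"
  shows "fps_nth (h * f) n = fps_nth (h * g) n"
  unfolding fps_mult_nth by (intro sum.cong) (use assms in auto)

lemma fps_exp_compose_deriv:
  fixes f :: "'a::field_char_0 fps"
  assumes "fps_nth f 0 = 0"
  shows "fps_deriv (fps_exp 1 oo f) = fps_deriv f * (fps_exp 1 oo f)"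
  using fps_compose_deriv[OF assms, of "fps_exp 1"] by (simp add: mult.commute)

lemma fps_exp_compose_add:
  fixes f g :: "'a::field_char_0 fps"
  assumes "fps_nth f 0 = 0" "fps_nth g 0 = 0"
  shows "fps_exp 1 oo (f + g) = (fps_exp 1 oo f) * (fps_exp 1 oo g)"
proof (rule fps_linear_ode_unique)
  show "fps_deriv (fps_exp 1 oo (f + g)) = fps_deriv (f + g) * (fps_exp 1 oo (f + g))"
    by (rule fps_exp_compose_deriv) (simp add: assms)
  show "fps_deriv ((fps_exp 1 oo f) * (fps_exp 1 oo g)) =
      fps_deriv (f + g) * ((fps_exp 1 oo f) * (fps_exp 1 oo g))"
    unfolding fps_deriv_mult fps_exp_compose_deriv[OF assms(1)] fps_exp_compose_deriv[OF assms(2)]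
    by (simp add: algebra_simps)
qed simp

text \<open>The partial sums satisfy the differential equation of the exponential up to a shift of the
  summation bound by at most two. The induction on \<open>n\<close> absorbs this shift, as the bound \<open>2n\<close>
  also decreases by two.\<close>

lemma fps_nth_exp_eq_partial:
  fixes u :: "'a::field_char_0"
  assumes T0: "fps_nth T 0 = 0" and B0: "fps_nth B 0 = 0" and "2 * n \<le> N"
  shows "fps_nth (fps_exp 1 oo (fps_const (u ^ 2 / 2) * T + fps_const u * B)) n =
    fps_nth (exp_partial T B u N) n"
  using assms(3)
proof (induction n arbitrary: N rule: less_induct)
  case (less n)
  let ?A = "fps_const (u ^ 2 / 2) * T + fps_const u * B"
  let ?X = "fps_exp 1 oo ?A"
  show ?case
  proof (cases n)
    case 0
    have "fps_nth (exp_partial T B u N) 0 = (\<Sum>a\<le>N. if a = 0 then 1 else 0)"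
      unfolding exp_partial_def fps_sum_nth
      by (intro sum.cong refl) (use exp_coeff_nth_eq_0[OF T0 B0, of 0] in \<open>auto simp: numeral_2_eq_2\<close>)
    then show ?thesis using 0 by simp
  next
    case (Suc m)
    then obtain M where N: "N = Suc (Suc M)" and M: "2 * m \<le> M"
      using less.prems by (metis add_2_eq_Suc le_Suc_ex mult_Suc_right add.assoc le_add1)
    have IH: "fps_nth ?X i = fps_nth (exp_partial T B u K) i" if "i \<le> m" "M \<le> K" for i K
      using less.IH[of i K] that M Suc by simp
    have "of_nat (Suc m) * fps_nth ?X (Suc m) = fps_nth (fps_deriv ?X) m" by simp
    also have "fps_deriv ?X = fps_deriv ?A * ?X"
      by (rule fps_exp_compose_deriv) (simp add: T0 B0)
    also have "\<dots> = fps_const (u ^ 2 / 2) * fps_deriv T * ?X + fps_const u * fps_deriv B * ?X"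
      by (simp add: algebra_simps)
    also have "fps_nth \<dots> m = fps_nth (fps_deriv (exp_partial T B u N)) m"
      unfolding N fps_deriv_exp_partial fps_add_nth
      by (intro arg_cong2[of _ _ _ _ plus] fps_mult_nth_cong IH) auto
    also have "\<dots> = of_nat (Suc m) * fps_nth (exp_partial T B u N) (Suc m)" by simp
    finally show ?thesis using Suc by (simp del: of_nat_Suc)
  qed
qed

section \<open>Trigonometric series\<close>

lemma fps_tan_sec_derivs:
  fixes S T :: "'a::field_char_0 fps"
  defines "S \<equiv> 1 / fps_cos 2" and "T \<equiv> fps_tan 2"
  shows "S ^ 2 = 1 + T ^ 2" "fps_deriv T = 2 * (1 + T ^ 2)" "fps_deriv S = 2 * T * S"
    "fps_nth S 0 = 1" "fps_nth T 0 = 0"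
proof -
  let ?c = "fps_cos 2 :: 'a fps" and ?s = "fps_sin 2 :: 'a fps"
  have S: "S = inverse ?c" unfolding S_def by (subst fps_divide_unit) simp_all
  have T: "T = ?s * S" unfolding T_def fps_tan_def S by (rule fps_divide_unit) simp
  have cS: "?c * S = 1" using inverse_mult_eq_1[of ?c] by (simp add: S mult.commute)
  have "S ^ 2 = (?c ^ 2 + ?s ^ 2) * S ^ 2" by (simp add: fps_sin_cos_sum_of_squares)
  also have "\<dots> = (?c * S) ^ 2 + T ^ 2" by (simp add: T algebra_simps power2_eq_square)
  finally show sq: "S ^ 2 = 1 + T ^ 2" by (simp add: cS)
  have dc: "fps_deriv ?c = - 2 * ?s"
    by (simp add: fps_cos_deriv numeral_fps_const flip: fps_const_neg)
  have "fps_deriv S = - fps_deriv ?c * S ^ 2"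
    unfolding S by (rule fps_inverse_deriv) simp
  then show dS: "fps_deriv S = 2 * T * S"
    by (simp add: dc T power2_eq_square mult_ac)
  have "fps_deriv T = ?s * fps_deriv S + 2 * (?c * S)"
    by (simp add: T fps_sin_deriv numeral_fps_const mult_ac)
  also have "?s * fps_deriv S = 2 * T ^ 2"
    unfolding dS by (simp add: T power2_eq_square mult_ac)
  finally have "fps_deriv T = 2 * T ^ 2 + 2 * (?c * S)" .
  then show "fps_deriv T = 2 * (1 + T ^ 2)"
    unfolding cS by (simp add: algebra_simps)
  show "fps_nth S 0 = 1" "fps_nth T 0 = 0" by (simp_all add: S T)
qed

lemma fps_deriv_inverse_sqrt_cos:
  fixes R :: "'a::field_char_0 fps"
  defines "R \<equiv> 1 / fps_sqrt1 (fps_cos 2)"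
  shows "fps_deriv R = fps_tan 2 * R" "fps_nth R 0 = 1"
proof -
  define Q :: "'a fps" where "Q = fps_sqrt1 (fps_cos 2)"
  let ?s = "fps_sin 2 :: 'a fps"
  have Q2: "Q ^ 2 = fps_cos 2" and Q0: "fps_nth Q 0 = 1"
    unfolding Q_def by (rule fps_sqrt1; simp)+
  have R: "R = inverse Q" unfolding R_def Q_def[symmetric] using Q0 by (subst fps_divide_unit) simp_all
  have RQ: "Q * R = 1" using inverse_mult_eq_1[of Q] Q0 by (simp add: R mult.commute)
  have T: "fps_tan 2 = ?s * R ^ 2"
    unfolding fps_tan_def R fps_inverse_power[symmetric] Q2 by (rule fps_divide_unit) simp
  have "of_nat (Suc 1) * (Q * fps_deriv Q) = of_nat (Suc 1) * (- ?s)"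
    using arg_cong[OF Q2, of fps_deriv]
    by (simp add: power2_eq_square fps_cos_deriv numeral_fps_const mult_ac flip: fps_const_neg)
  then have "Q * fps_deriv Q = - ?s" by (rule of_nat_fps_cancel)
  then have dQ: "?s = - (Q * fps_deriv Q)" by simp
  have "fps_deriv R = - fps_deriv Q * R ^ 2"
    using Q0 by (simp add: R fps_inverse_deriv)
  also have "\<dots> = - fps_deriv Q * R ^ 2 * (Q * R)" unfolding RQ by simp
  also have "\<dots> = - (Q * fps_deriv Q) * R ^ 2 * R" by (simp add: mult_ac)
  finally show "fps_deriv R = fps_tan 2 * R" by (simp add: T dQ)
  show "fps_nth R 0 = 1" using Q0 by (simp add: R)
qed

section \<open>The generating function\<close>

text \<open>Over all diagrams, the series multiplying \<open>u ^ a\<close> also contains the factor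
  \<open>sqrt (sec 2z) * exp (v\<^sup>2 / 2 * tan 2z)\<close>. Its logarithmic derivative is the term that
  \<open>exp_coeff_heat\<close> carries on the left; absorbing it into the derivative turns that lemma into
  the node-appending recurrence, read as a differential equation in \<open>z\<close>.\<close>

lemma deriv_scaled_exp_coeff:
  assumes "fps_deriv T = 2 * (1 + T ^ 2)" "fps_deriv B = 2 * T * (B + V)"
    and "(B + V) ^ 2 = V ^ 2 * (1 + T ^ 2)"
    and dM: "fps_deriv M = (T + V ^ 2 * (1 + T ^ 2)) * M"
  shows "fps_deriv (M * exp_coeff T B (a + 2)) =
    M * exp_coeff T B a + V ^ 2 * (M * exp_coeff T B (a + 2))
    + of_nat (2 * (a + 1)) * V * (M * exp_coeff T B (a + 3))
    + of_nat ((a + 2) * (a + 1)) * (M * exp_coeff T B (a + 4))"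
proof -
  have "fps_deriv (M * exp_coeff T B (a + 2)) =
    M * (fps_deriv (exp_coeff T B (a + 2)) + (T + V ^ 2 * (1 + T ^ 2)) * exp_coeff T B (a + 2))"
    unfolding fps_deriv_mult dM by (simp only: algebra_simps)
  then show ?thesis
    unfolding exp_coeff_heat[OF assms(1-3)] by (simp only: algebra_simps)
qed

text \<open>Both sides have the same initial values and satisfy the same recurrence: appending a last
  node on the one side, the differential equation of \<open>deriv_scaled_exp_coeff\<close> on the other.\<close>

lemma output_weight_eq_nth:
  fixes v :: "'a::field_char_0"
  assumes T0: "fps_nth T 0 = 0" and B0: "fps_nth B 0 = 0" and M0: "fps_nth M 0 = 1"
    and d: "fps_deriv T = 2 * (1 + T ^ 2)" "fps_deriv B = 2 * T * (B + fps_const v)"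
    "(B + fps_const v) ^ 2 = fps_const v ^ 2 * (1 + T ^ 2)"
    "fps_deriv M = (T + fps_const v ^ 2 * (1 + T ^ 2)) * M"
  shows "fps_nth (M * exp_coeff T B (a + 2)) n = output_weight v n a / fact n"
proof (induction n arbitrary: a)
  case 0
  show ?case
    using exp_coeff_nth_eq_0[OF T0 B0, of 0 "a + 2"] M0
    by (cases a) (auto simp: output_weight_0 numeral_2_eq_2)
next
  case (Suc n)
  let ?g = "\<lambda>a. M * exp_coeff T B a"
  have IH: "fps_nth (?g (a + 2)) n = output_weight v n a / fact n"
    "fps_nth (?g (a + 3)) n = output_weight v n (a + 1) / fact n"
    "fps_nth (?g (a + 4)) n = output_weight v n (a + 2) / fact n"
    using Suc[of a] Suc[of "a + 1"] Suc[of "a + 2"]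
    by (simp_all only: add.assoc one_add_one numeral_plus_numeral add_num_simps one_plus_numeral)
  have IH0: "fps_nth (?g a) n = (if a < 2 then 0 else output_weight v n (a - 2)) / fact n"
  proof (cases "a < 2")
    case True
    then have "a = 0 \<or> a = Suc 0" by auto
    then show ?thesis by auto
  next
    case False
    then have "a - 2 + 2 = a" by simp
    then show ?thesis using False Suc[of "a - 2"] by simp
  qed
  have "of_nat (Suc n) * fps_nth (?g (a + 2)) (Suc n) = fps_nth (fps_deriv (?g (a + 2))) n"
    by (simp only: fps_deriv_nth Suc_eq_plus1)
  also have "\<dots> = fps_nth (?g a) n + v ^ 2 * fps_nth (?g (a + 2)) n
      + (of_nat (2 * (a + 1)) * v) * fps_nth (?g (a + 3)) n
      + of_nat ((a + 2) * (a + 1)) * fps_nth (?g (a + 4)) n"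
    unfolding deriv_scaled_exp_coeff[OF d] fps_add_nth fps_of_nat[symmetric] fps_const_power fps_const_mult
      fps_mult_left_const_nth ..
  also have "\<dots> = output_weight v (Suc n) a / fact n"
    unfolding IH IH0 output_weight_Suc by (simp add: add_divide_distrib)
  finally show ?case
    by (simp add: field_simps del: of_nat_Suc)
qed

theorem proposition8:
  fixes u v :: "'a::field_char_0"
  shows "diagram_gf u v =
           1 / fps_sqrt1 (fps_cos 2) *
           fps_compose (fps_exp 1)
             (fps_const (1 / 2) * (fps_const (u ^ 2) + fps_const (v ^ 2)) * fps_tan 2
              + fps_const (u * v) * (1 / fps_cos 2 - 1))"
proof -
  define T :: "'a fps" where "T = fps_tan 2"
  define S :: "'a fps" where "S = 1 / fps_cos 2"
  define R :: "'a fps" where "R = 1 / fps_sqrt1 (fps_cos 2)"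
  define V where "V = fps_const v"
  define B where "B = V * (S - 1)"
  define X where "X = fps_exp 1 oo (fps_const (v ^ 2 / 2) * T)"
  define M where "M = R * X"
  define A where "A = fps_const (u ^ 2 / 2) * T + fps_const u * B"
  note TS = fps_tan_sec_derivs[where 'a = 'a, folded T_def S_def]
  note R = fps_deriv_inverse_sqrt_cos[where 'a = 'a, folded R_def T_def]
  have T0: "fps_nth T 0 = 0" and B0: "fps_nth B 0 = 0"
    using TS(4,5) by (simp_all add: B_def)
  have BV: "B + V = V * S" by (simp add: B_def algebra_simps)
  have dB: "fps_deriv B = 2 * T * (B + V)"
    unfolding BV by (simp add: B_def V_def TS(3) mult_ac)
  have sq: "(B + V) ^ 2 = V ^ 2 * (1 + T ^ 2)"
    unfolding BV power_mult_distrib TS(1) ..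
  have vv: "fps_const (v ^ 2 / 2) * 2 = V ^ 2"
    by (simp add: V_def numeral_fps_const)
  have "fps_deriv X = (fps_const (v ^ 2 / 2) * 2) * (1 + T ^ 2) * X"
    unfolding X_def by (subst fps_exp_compose_deriv) (simp_all add: T0 TS(2) mult.assoc)
  then have "fps_deriv M = R * (V ^ 2 * (1 + T ^ 2) * X) + T * R * X"
    by (simp only: M_def fps_deriv_mult R(1) vv)
  then have dM: "fps_deriv M = (T + V ^ 2 * (1 + T ^ 2)) * M"
    by (simp only: M_def algebra_simps)
  have M0: "fps_nth M 0 = 1" by (simp add: M_def X_def R(2))
  have "diagram_gf u v = M * (fps_exp 1 oo A)"
  proof (rule fps_ext)
    fix n
    have "fps_nth (diagram_gf u v) n = (\<Sum>a\<le>2 * n. u ^ a * (output_weight v n a / fact n))"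
      by (simp add: diagram_gf_def sum_diagram_count[symmetric] sum_distrib_left
          sum_divide_distrib mult_ac)
    also have "\<dots> = fps_nth (M * exp_partial T B u (2 * n)) n"
      unfolding exp_partial_def sum_distrib_left fps_sum_nth mult.left_commute[of M]
        fps_mult_left_const_nth
        output_weight_eq_nth[OF T0 B0 M0 TS(2) dB[unfolded V_def] sq[unfolded V_def] dM[unfolded V_def]] ..
    also have "\<dots> = fps_nth (M * (fps_exp 1 oo A)) n"
      unfolding A_def
      by (intro fps_mult_nth_cong fps_nth_exp_eq_partial[OF T0 B0, symmetric]) simp
    finally show "fps_nth (diagram_gf u v) n = fps_nth (M * (fps_exp 1 oo A)) n" .
  qed
  also have "\<dots> = R * (fps_exp 1 oo (fps_const (v ^ 2 / 2) * T + A))"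
    unfolding M_def X_def
    by (subst fps_exp_compose_add) (simp_all add: A_def T0 B0 mult.assoc)
  also have "fps_const (v ^ 2 / 2) * T + A =
      fps_const (1 / 2) * (fps_const (u ^ 2) + fps_const (v ^ 2)) * T + fps_const (u * v) * (S - 1)"
  proof -
    have scalars: "fps_const (v ^ 2 / 2) = fps_const (1 / 2) * fps_const (v ^ 2)"
      "fps_const (u ^ 2 / 2) = fps_const (1 / 2) * fps_const (u ^ 2)"
      "fps_const (u * v) = fps_const u * V"
      by (simp_all add: V_def)
    show ?thesis unfolding A_def B_def scalars by (simp only: algebra_simps)
  qed
  finally show ?thesis unfolding R_def T_def S_def .
qed

end
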